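(* Let $\mathbb F_q$ be a finite field of characteristic $p$ and $\mathbf w=(w_0,\dots,w_n)$ a vector of positive integers. For an integer $e\ge1$ set $n(e)=\#\{i\in\{0,\dots,n\}: e\mid w_i\}$. Then for every $r\ge1$, $$A_{\mathbf w}(q^r)=\sum_{\substack{e\ge1,\ p\nmid e\\ o_e\mid r}}\varphi(e)\,\frac{q^{r\,n(e)}-1}{q^r-1}=\sum_{\substack{e\ge1,\ p\nmid e\\ o_e\mid r}}\varphi(e)\,\#\mathbb P^{\,n(e)-1}(\mathbb F_{q^r}),$$ and consequently $$Z_{\mathrm{tw}}(\mathcal P_{\mathbf w},t)=\prod_{\substack{e\ge1,\ p\nmid e\\ n(e)\ge1}}\ \prod_{j=0}^{n(e)-1}\bigl(1-(q^jt)^{o_e}\bigr)^{-\varphi(e)/o_e},$$ a finite product in which the numbers $\varphi(e)/o_e$ are positive integers. In particular $Z_{\mathrm{tw}}(\mathcal P_{\mathbf w},t)^{-1}\in\mathbb Z[t]$, i.e. the twist zeta function has poles only.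
   Context: For $r\ge 1$, $A_{\mathbf w}(q^r)$ is the number of orbits of $\mathbb F_{q^r}^\times$ on $\mathbb F_{q^r}^{n+1}\setminus\{0\}$ under $\lambda\cdot(x_0,\dots,x_n)=(\lambda^{w_0}x_0,\dots,\lambda^{w_n}x_n)$, and $Z_{\mathrm{tw}}(\mathcal P_{\mathbf w},t)=\exp\bigl(\sum_{r\ge1}A_{\mathbf w}(q^r)\,t^r/r\bigr)$. For $e$ prime to $p$, $o_e$ is the multiplicative order of $q$ modulo $e$, with $o_1=1$. $\varphi$ is Euler's totient function. Terms with $n(e)=0$ are zero ($\mathbb P^{-1}$ is empty). *)

theory Defs
  imports
    "HOL-Algebra.Group_Action"
    "HOL-Algebra.Multiplicative_Group"
    "HOL-Number_Theory.Number_Theory"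
    "HOL-Computational_Algebra.Computational_Algebra"
begin

definition ring_characteristic :: "('a, 'm) ring_scheme \<Rightarrow> nat" where
  "ring_characteristic R =
     (if \<exists>m::nat>0. [m] \<cdot>\<^bsub>R\<^esub> \<one>\<^bsub>R\<^esub> = \<zero>\<^bsub>R\<^esub>
      then LEAST m::nat. m > 0 \<and> [m] \<cdot>\<^bsub>R\<^esub> \<one>\<^bsub>R\<^esub> = \<zero>\<^bsub>R\<^esub> else 0)"

definition nonzero_vectors :: "('a, 'm) ring_scheme \<Rightarrow> nat set \<Rightarrow> (nat \<Rightarrow> 'a) set" where
  "nonzero_vectors K I = (I \<rightarrow>\<^sub>E carrier K) - {\<lambda>i\<in>I. \<zero>\<^bsub>K\<^esub>}"

definition weighted_scaling ::
    "('a, 'm) ring_scheme \<Rightarrow> (nat \<Rightarrow> nat) \<Rightarrow> nat set \<Rightarrow> 'a \<Rightarrow> (nat \<Rightarrow> 'a) \<Rightarrow> (nat \<Rightarrow> 'a)" where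
  "weighted_scaling K w I l =
     (\<lambda>x\<in>nonzero_vectors K I. \<lambda>i\<in>I. (l [^]\<^bsub>K\<^esub> w i) \<otimes>\<^bsub>K\<^esub> x i)"

text \<open>For a field \<open>K\<close> with \<open>Q\<close> elements and \<open>w = (w 0, \<dots>, w n)\<close> this is \<open>A\<^sub>w(Q)\<close>.\<close>

definition weighted_orbit_count :: "('a, 'm) ring_scheme \<Rightarrow> (nat \<Rightarrow> nat) \<Rightarrow> nat \<Rightarrow> nat" where
  "weighted_orbit_count K w n =
     card (orbits (mult_of K) (nonzero_vectors K {0..n}) (weighted_scaling K w {0..n}))"

text \<open>The points of the projective space of dimension \<open>N - 1\<close> over \<open>K\<close>; the argument is the
  number \<open>N\<close> of homogeneous coordinates, so that \<open>N = 0\<close> gives the empty set.\<close>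

definition projective_points :: "('a, 'm) ring_scheme \<Rightarrow> nat \<Rightarrow> (nat \<Rightarrow> 'a) set set" where
  "projective_points K N =
     orbits (mult_of K) (nonzero_vectors K {0..<N})
       (\<lambda>l. \<lambda>x\<in>nonzero_vectors K {0..<N}. \<lambda>i\<in>{0..<N}. l \<otimes>\<^bsub>K\<^esub> x i)"

definition weight_multiplicity :: "(nat \<Rightarrow> nat) \<Rightarrow> nat \<Rightarrow> nat \<Rightarrow> nat" where
  "weight_multiplicity w n e = card {i\<in>{0..n}. e dvd w i}"

text \<open>\<open>F r\<close> is meant to be a field with \<open>q ^ r\<close> elements; \<open>F 0\<close> is not used.\<close>

definition twist_zeta :: "(nat \<Rightarrow> ('a, 'm) ring_scheme) \<Rightarrow> (nat \<Rightarrow> nat) \<Rightarrow> nat \<Rightarrow> rat fps" where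
  "twist_zeta F w n =
     fps_exp 1 oo
       Abs_fps (\<lambda>r. if r = 0 then 0 else of_nat (weighted_orbit_count (F r) w n) / of_nat r)"

end

theory Submission
  imports Defs "HOL-Algebra.Sylow"
begin

text \<open>
  Put \<open>Q = q\<^sup>r\<close>. A scalar \<open>l\<close> of multiplicative order \<open>e\<close> fixes exactly the vectors supported on the
  coordinates with \<open>e dvd w i\<close>, and the cyclic multiplicative group has \<open>totient e\<close> elements of each
  order \<open>e dvd Q - 1\<close>; Burnside's lemma gives the orbit count. Every prime divisor of \<open>q\<close> is \<open>p\<close>,
  so \<open>e dvd Q - 1\<close> means that \<open>\<not> p dvd e\<close> and \<open>ord e q dvd r\<close>. Expanding
  \<open>(Q\<^sup>N - 1) / (Q - 1)\<close> as a geometric sum splits the exponent of the zeta function into one series for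
  each factor \<open>1 - (q\<^sup>j X)\<^sup>d\<close>, namely a multiple of minus its logarithm, which is recognised by
  its logarithmic derivative.
\<close>

section \<open>Totients, nonzero vectors and orbits\<close>

lemma phi'_eq_totient: "phi' n = totient n"
  by (simp add: phi'_def totient_def totatives_def Suc_le_eq conj_ac)

lemma nonzero_vectors_iff:
  "x \<in> nonzero_vectors R I \<longleftrightarrow> x \<in> I \<rightarrow>\<^sub>E carrier R \<and> (\<exists>i\<in>I. x i \<noteq> \<zero>\<^bsub>R\<^esub>)"
proof -
  have "x = (\<lambda>i\<in>I. \<zero>\<^bsub>R\<^esub>) \<longleftrightarrow> (\<forall>i\<in>I. x i = \<zero>\<^bsub>R\<^esub>)" if "x \<in> I \<rightarrow>\<^sub>E carrier R"
    using that by (auto simp: fun_eq_iff PiE_def extensional_def)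
  thus ?thesis
    by (auto simp: nonzero_vectors_def)
qed

text \<open>Needed to treat projective space as the case of weights 1: the two scaling maps are
  known to agree only for scalars in the carrier, where \<open>l [^] 1 = l\<close>.\<close>

lemma orbits_cong:
  assumes "\<And>g x. g \<in> carrier G \<Longrightarrow> x \<in> E \<Longrightarrow> \<phi> g x = \<psi> g x"
  shows "orbits G E \<phi> = orbits G E \<psi>"
proof -
  have "orbit G \<phi> x = orbit G \<psi> x" if "x \<in> E" for x
    using assms that unfolding orbit_def by (intro Collect_cong ex_cong1) auto
  thus ?thesis
    unfolding orbits_def by (intro Collect_cong ex_cong1) auto
qed

section \<open>The weighted action of the multiplicative group of a field\<close>

context field
begin

lemma one_less_card: "finite (carrier R) \<Longrightarrow> card (carrier R) > 1"
  using card_mono[of "carrier R" "{\<zero>, \<one>}"] by simp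

text \<open>Powers of a nonzero scalar are nonzero, so scaling does not change which coordinates
  vanish.\<close>

lemma weighted_scaling_closed:
  assumes "l \<in> carrier R - {\<zero>}" "x \<in> nonzero_vectors R I"
  shows "weighted_scaling R w I l x \<in> nonzero_vectors R I"
proof -
  have "l [^] w i \<in> carrier R - {\<zero>}" for i
    using monoid.nat_pow_closed[of "mult_of R" l "w i"] group.is_monoid[OF field_mult_group] assms
    by (simp add: nat_pow_mult_of)
  hence "(l [^] w i) \<otimes> x i = \<zero> \<longleftrightarrow> x i = \<zero>" if "i \<in> I" for i
    using that assms by (auto simp: nonzero_vectors_iff integral_iff PiE_iff)
  thus ?thesis
    using assms by (auto simp: nonzero_vectors_iff weighted_scaling_def PiE_iff)
qed

lemma weighted_scaling_mult:
  assumes "l \<in> carrier R - {\<zero>}" "m \<in> carrier R - {\<zero>}" "x \<in> nonzero_vectors R I"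
  shows "weighted_scaling R w I (l \<otimes> m) x = weighted_scaling R w I l (weighted_scaling R w I m x)"
proof -
  have "weighted_scaling R w I m x \<in> nonzero_vectors R I"
    using assms by (intro weighted_scaling_closed)
  thus ?thesis
    using assms
    by (auto simp: weighted_scaling_def nonzero_vectors_iff PiE_iff fun_eq_iff nat_pow_distrib m_assoc)
qed

lemma weighted_scaling_one:
  assumes "x \<in> nonzero_vectors R I"
  shows "weighted_scaling R w I \<one> x = x"
  using assms
  by (auto simp: weighted_scaling_def nonzero_vectors_iff PiE_iff extensional_def fun_eq_iff)

lemma group_action_weighted_scaling:
  "group_action (mult_of R) (nonzero_vectors R I) (weighted_scaling R w I)"
proof -
  interpret G: group "mult_of R"
    by (rule field_mult_group)
  let ?E = "nonzero_vectors R I" and ?\<phi> = "weighted_scaling R w I"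
  have bij: "?\<phi> l \<in> Bij ?E" if l: "l \<in> carrier R - {\<zero>}" for l
  proof -
    have inv: "inv l \<in> carrier R - {\<zero>}" "l \<otimes> inv l = \<one>" "inv l \<otimes> l = \<one>"
      using l Units_inv_Units[of l] by (auto simp: field_Units)
    \<comment> \<open>Scaling by \<open>inv l\<close> is the inverse map.\<close>
    have "bij_betw (?\<phi> l) ?E ?E"
      using l inv
      by (intro bij_betwI[where g = "?\<phi> (inv l)"])
         (auto simp: weighted_scaling_closed weighted_scaling_one weighted_scaling_mult [symmetric])
    thus ?thesis
      by (simp add: Bij_def weighted_scaling_def)
  qed
  have "?\<phi> (l \<otimes> m) = compose ?E (?\<phi> l) (?\<phi> m)"
    if "l \<in> carrier R - {\<zero>}" "m \<in> carrier R - {\<zero>}" for l m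
  proof
    \<comment> \<open>Equality is needed as functions: outside \<open>?E\<close> both sides are
      \<open>undefined\<close>, by the restrictions in \<open>weighted_scaling\<close> and
      \<open>compose\<close>.\<close>
    fix x
    show "?\<phi> (l \<otimes> m) x = compose ?E (?\<phi> l) (?\<phi> m) x"
      using that weighted_scaling_mult[of l m x I w]
      by (cases "x \<in> ?E") (auto simp: compose_def weighted_scaling_def)
  qed
  hence "?\<phi> \<in> hom (mult_of R) (BijGroup ?E)"
    using bij by (auto simp: hom_def BijGroup_def)
  thus ?thesis
    by (simp add: group_action_def group_hom_def group_hom_axioms_def group_BijGroup)
qed

section \<open>Fixed vectors, elements of given order and Burnside's count\<close>

text \<open>In a fixed vector the coordinates with \<open>l [^] w i = \<one>\<close> are free and
  all others are zero. So the fixed vectors together with the zero vector form a coordinate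
  subspace, and the final \<open>- 1\<close> removes zero.\<close>

lemma card_invariants_weighted_scaling:
  assumes "finite (carrier R)" "finite I" "l \<in> carrier R - {\<zero>}"
  shows "card (invariants (nonzero_vectors R I) (weighted_scaling R w I) l) =
           card (carrier R) ^ card {i\<in>I. l [^] w i = \<one>} - 1"
proof -
  define B where "B = (\<Pi>\<^sub>E i\<in>I. if l [^] w i = \<one> then carrier R else {\<zero>})"
  \<comment> \<open>A nonzero \<open>a\<close> can be cancelled, which leaves
    \<open>l [^] w i = \<one>\<close>.\<close>
  have fixed: "(l [^] w i) \<otimes> a = a \<longleftrightarrow> a \<in> (if l [^] w i = \<one> then carrier R else {\<zero>})"
    if "a \<in> carrier R" for i a
    using that assms m_rcancel[of a "l [^] w i" \<one>] by auto
  have sub: "a \<in> (if l [^] w i = \<one> then carrier R else {\<zero>}) \<Longrightarrow> a \<in> carrier R" for i a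
    by (auto split: if_splits)
  have "invariants (nonzero_vectors R I) (weighted_scaling R w I) l = B - {\<lambda>i\<in>I. \<zero>}"
  proof (intro Set.set_eqI)
    fix x
    have "x \<in> invariants (nonzero_vectors R I) (weighted_scaling R w I) l \<longleftrightarrow>
            x \<in> nonzero_vectors R I \<and> (\<forall>i\<in>I. (l [^] w i) \<otimes> x i = x i)"
      by (auto simp: invariants_def weighted_scaling_def nonzero_vectors_iff fun_eq_iff
          PiE_iff extensional_def)
    also have "\<dots> \<longleftrightarrow> x \<in> B - {\<lambda>i\<in>I. \<zero>}"
      unfolding nonzero_vectors_def B_def PiE_iff Diff_iff using fixed sub by blast
    finally show "x \<in> invariants (nonzero_vectors R I) (weighted_scaling R w I) l \<longleftrightarrow>
      x \<in> B - {\<lambda>i\<in>I. \<zero>}" .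
  qed
  moreover have "(\<lambda>i\<in>I. \<zero>) \<in> B" "finite B"
    using assms by (auto simp: B_def intro!: finite_PiE)
  moreover have "card B = card (carrier R) ^ card {i\<in>I. l [^] w i = \<one>}"
    using assms by (simp add: B_def card_PiE if_distrib [of card] prod.If_cases Int_def)
  ultimately show ?thesis
    by (simp add: card_Diff_singleton)
qed

text \<open>The known count of elements of order \<open>d\<close> presupposes one such element.
  Cyclicity of the multiplicative group supplies it as a power of a generator.\<close>

lemma card_elems_of_ord_eq_totient:
  assumes "finite (carrier R)" "d dvd card (carrier R) - 1"
  shows "card {a \<in> carrier (mult_of R). group.ord (mult_of R) a = d} = totient d"
proof -
  interpret G: group "mult_of R"
    rewrites "([^]\<^bsub>mult_of R\<^esub>) = (([^]) :: _ \<Rightarrow> nat \<Rightarrow> _)"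
    by (rule field_mult_group) (simp add: nat_pow_mult_of)
  have dvd: "d dvd Coset.order (mult_of R)"
    using assms by (simp add: order_mult_of Coset.order_def)
  have fin: "finite (carrier (mult_of R))"
    using assms by simp
  obtain g where g: "g \<in> carrier (mult_of R)"
    "carrier (mult_of R) = {g [^] i | i::nat. i \<in> UNIV}"
    using finite_field_mult_group_has_gen[OF assms(1)] by blast
  have ne0: "G.ord g \<noteq> 0"
    using G.ord_ge_1[OF fin g(1)] by simp
  hence "G.ord g = Coset.order (mult_of R)"
    unfolding Coset.order_def g(2)
    by (subst G.generate_pow_card[OF g(1)], subst G.generate_pow_nat[OF g(1) ne0]) simp
  then obtain k where k: "G.ord g = d * k"
    using dvd by auto
  \<comment> \<open>Since \<open>G.ord g = d * k\<close>, raising the generator to the power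
    \<open>k\<close> divides its order by \<open>k\<close>.\<close>
  have "G.ord (g [^] k) = d"
    using G.ord_pow[OF g(1), of k] k ne0 by simp
  moreover have "g [^] k \<in> carrier (mult_of R)"
    using G.nat_pow_closed[OF g(1)] .
  ultimately show ?thesis
    using num_elems_of_ord_eq_phi'[OF assms(1) dvd] by (auto simp: phi'_eq_totient)
qed

text \<open>Burnside's lemma, with the group order kept as a factor on the left so that the identity
  stays in the natural numbers. The number of vectors fixed by \<open>l\<close> depends only on the
  order \<open>e\<close> of \<open>l\<close>, because \<open>l [^] w i = \<one>\<close> holds
  exactly when \<open>e dvd w i\<close>.\<close>

theorem card_orbits_weighted_scaling:
  assumes "finite (carrier R)" "finite I"
  shows "card (orbits (mult_of R) (nonzero_vectors R I) (weighted_scaling R w I)) *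
           (card (carrier R) - 1) =
         (\<Sum>e | e dvd card (carrier R) - 1.
            totient e * (card (carrier R) ^ card {i\<in>I. e dvd w i} - 1))"
proof -
  interpret G: group "mult_of R"
    rewrites "([^]\<^bsub>mult_of R\<^esub>) = (([^]) :: _ \<Rightarrow> nat \<Rightarrow> _)" and "\<one>\<^bsub>mult_of R\<^esub> = \<one>"
    by (rule field_mult_group) (simp_all add: nat_pow_mult_of)
  interpret group_action "mult_of R" "nonzero_vectors R I" "weighted_scaling R w I"
    by (rule group_action_weighted_scaling)
  let ?Q = "card (carrier R)"
  let ?f = "\<lambda>e. ?Q ^ card {i\<in>I. e dvd w i} - 1"
  have ord: "Coset.order (mult_of R) = ?Q - 1"
    using assms by (simp add: order_mult_of Coset.order_def)
  have fin: "finite (carrier (mult_of R))" 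
    using assms by simp
  \<comment> \<open>The number 0 has infinitely many divisors, so the sum over divisors needs
    \<open>?Q - 1\<close> to be positive.\<close>
  have "?Q - 1 > 0"
    using G.order_gt_0_iff_finite fin ord by simp
  hence finD: "finite {e. e dvd ?Q - 1}"
    by simp
  have "finite (nonzero_vectors R I)"
    using assms by (auto simp: nonzero_vectors_def intro!: finite_PiE)
  hence "card (orbits (mult_of R) (nonzero_vectors R I) (weighted_scaling R w I)) * (?Q - 1) =
      (\<Sum>l\<in>carrier (mult_of R). card (invariants (nonzero_vectors R I) (weighted_scaling R w I) l))"
    using burnside[OF fin] ord by simp
  also have "\<dots> = (\<Sum>l\<in>carrier (mult_of R). ?f (G.ord l))"
  proof (intro sum.cong refl)
    fix l assume l: "l \<in> carrier (mult_of R)"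
    show "card (invariants (nonzero_vectors R I) (weighted_scaling R w I) l) = ?f (G.ord l)"
      using card_invariants_weighted_scaling[OF assms, of l w] l G.pow_eq_id[OF l] by simp
  qed
  \<comment> \<open>Elements are grouped by their order, which divides \<open>?Q - 1\<close> by
    Lagrange's theorem.\<close>
  also have "\<dots> = (\<Sum>e | e dvd ?Q - 1. \<Sum>l | l \<in> carrier (mult_of R) \<and> G.ord l = e. ?f (G.ord l))"
    using G.ord_dvd_group_order ord by (intro sum.group [symmetric] fin finD) auto
  also have "\<dots> = (\<Sum>e | e dvd ?Q - 1. totient e * ?f e)"
  proof (intro sum.cong refl)
    fix e assume "e \<in> {e. e dvd ?Q - 1}"
    thus "(\<Sum>l | l \<in> carrier (mult_of R) \<and> G.ord l = e. ?f (G.ord l)) = totient e * ?f e"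
      using card_elems_of_ord_eq_totient[OF assms(1), of e] by simp
  qed
  finally show ?thesis .
qed

text \<open>With all weights equal to 1 only \<open>e = 1\<close> contributes: for any other
  \<open>e\<close> no coordinate qualifies, and a zeroth power minus 1 remains.\<close>

corollary card_projective_points:
  assumes "finite (carrier R)"
  shows "card (projective_points R N) * (card (carrier R) - 1) = card (carrier R) ^ N - 1"
proof -
  have "projective_points R N = orbits (mult_of R) (nonzero_vectors R {0..<N})
          (weighted_scaling R (\<lambda>_. 1) {0..<N})"
    unfolding projective_points_def by (rule orbits_cong) (simp add: weighted_scaling_def)
  moreover have "(\<Sum>e | e dvd card (carrier R) - 1.
      totient e * (card (carrier R) ^ card {i\<in>{0..<N}. e dvd 1} - 1)) = card (carrier R) ^ N - 1"
  proof -
    have "card (carrier R) - 1 > 0"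
      using one_less_card[OF assms] by simp
    hence "finite {e. e dvd card (carrier R) - 1}" by simp
    moreover have "totient e * (card (carrier R) ^ card {i\<in>{0..<N}. e dvd 1} - 1) =
      (if e = 1 then card (carrier R) ^ N - 1 else 0)" for e
      by auto
    ultimately show ?thesis by simp
  qed
  ultimately show ?thesis
    using card_orbits_weighted_scaling[OF assms, of "{0..<N}" "\<lambda>_. 1"] by simp
qed

section \<open>The characteristic and the prime divisors of the number of elements\<close>

text \<open>Sylow's theorem for the additive group yields a nonzero \<open>x\<close> killed by \<open>l\<close>, and \<open>l\<close> times
  the unit then vanishes because there are no zero divisors.\<close>

lemma prime_dvd_card_imp_eq_ring_characteristic:
  fixes l :: nat
  assumes fin: "finite (carrier R)" and "prime l" "l dvd card (carrier R)"
  shows "l = ring_characteristic R"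
proof -
  let ?z = "\<lambda>m::nat. [m] \<cdot> \<one> = \<zero>"
  define a where "a = add.ord \<one>"
  have z: "?z m \<longleftrightarrow> a dvd m" for m
    using add.pow_eq_id[of \<one> m] by (simp add: a_def)
  have a0: "a > 0"
    using add.ord_ge_1[of \<one>] fin by (simp add: a_def)
  \<comment> \<open>Positivity of the additive order \<open>a\<close> of \<open>\<one>\<close> rules
    out the default characteristic 0.\<close>
  have "ring_characteristic R = (LEAST m::nat. m > 0 \<and> ?z m)"
    using a0 z[of a] unfolding ring_characteristic_def by (subst if_P) auto
  also have "\<dots> = a"
    using a0 z by (intro Least_equality) (auto dest: dvd_imp_le)
  finally have char: "ring_characteristic R = a" .
  have "a \<noteq> 1"
    using z[of 1] one_not_zero by auto
  \<comment> \<open>The exponent 1 makes Sylow's theorem give a subgroup of exactly \<open>l\<close>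
    elements, even if higher powers of \<open>l\<close> divide the group order.\<close>
  have "Coset.order (add_monoid R) = l ^ 1 * (card (carrier R) div l)"
    using assms by (simp add: Coset.order_def)
  then obtain H where H: "subgroup H (add_monoid R)" "card H = l ^ 1"
    using sylow_thm[OF \<open>prime l\<close> add.is_group] fin by fastforce
  interpret H: subgroup H "add_monoid R" by fact
  have "finite H"
    using H assms by (auto intro: card_ge_0_finite simp: prime_gt_0_nat)
  have "card H > 1"
    using H prime_gt_1_nat[OF \<open>prime l\<close>] by simp
  have "\<exists>x. x \<in> H \<and> x \<noteq> \<zero>"
  proof (rule ccontr)
    assume "\<not> ?thesis"
    hence "card H \<le> card {\<zero>}" by (intro card_mono) auto
    thus False using \<open>card H > 1\<close> by simp
  qed
  then obtain x where x: "x \<in> H" "x \<noteq> \<zero>" by blast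
  have xc: "x \<in> carrier R"
    using H.subset x(1) by auto
  have "x [^]\<^bsub>(add_monoid R)\<lparr>carrier := H\<rparr>\<^esub> card H = \<zero>"
    using group.pow_order_eq_1[OF add.subgroup_imp_group[OF H(1)], of x] x by (simp add: Coset.order_def)
  hence "[l] \<cdot> x = \<zero>"
    using H(2) by (simp add: add_pow_def nat_pow_def)
  hence "([l] \<cdot> \<one>) \<otimes> x = \<zero>"
    using xc add_pow_ldistr[of \<one> x l] by simp
  hence "?z l"
    using xc x(2) integral by auto
  hence "a dvd l"
    using z by simp
  with \<open>a \<noteq> 1\<close> \<open>prime l\<close> show ?thesis
    using char by (auto simp: prime_nat_iff)
qed

text \<open>The characteristic is the only prime divisor of the cardinality, which exceeds 1 and so
  has one. This turns the condition on \<open>p\<close> into the coprimality that multiplicative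
  orders require.\<close>

lemma coprime_card_iff_not_ring_characteristic_dvd:
  fixes e :: nat
  assumes "finite (carrier R)"
  shows "coprime e (card (carrier R)) \<longleftrightarrow> \<not> ring_characteristic R dvd e"
proof
  assume "\<not> ring_characteristic R dvd e"
  hence "\<not> (prime l \<and> l dvd gcd e (card (carrier R)))" for l
    using prime_dvd_card_imp_eq_ring_characteristic[OF assms, of l] by auto
  hence "gcd e (card (carrier R)) = 1"
    using prime_factor_nat by blast
  thus "coprime e (card (carrier R))"
    by (rule coprime_iff_gcd_eq_1 [THEN iffD2])
next
  assume *: "coprime e (card (carrier R))"
  have "card (carrier R) \<noteq> 1"
    using one_less_card[OF assms] by simp
  then obtain l where l: "prime l" "l dvd card (carrier R)"
    using prime_factor_nat by blast
  have "\<not> l dvd e"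
    using l * coprime_common_divisor[of e "card (carrier R)" l] not_prime_unit by blast
  thus "\<not> ring_characteristic R dvd e"
    using prime_dvd_card_imp_eq_ring_characteristic[OF assms l] by simp
qed

end

section \<open>Exponentials and logarithmic derivatives of power series\<close>

text \<open>The quotient of \<open>f\<close> by the exponential has derivative 0 and constant term
  1.\<close>

lemma fps_eq_exp_compose:
  fixes f g :: "'a::field_char_0 fps"
  assumes f0: "f $ 0 = 1" and g0: "g $ 0 = 0" and deriv: "fps_deriv f = fps_deriv g * f"
  shows "f = fps_exp 1 oo g"
proof -
  let ?E = "fps_exp 1 oo g"
  have E0: "?E $ 0 \<noteq> 0"
    by simp
  have E': "fps_deriv ?E = fps_deriv g * ?E"
    by (simp add: fps_compose_deriv[OF g0] mult.commute)
  have "fps_deriv (f * inverse ?E) = fps_deriv g * f * inverse ?E * (1 - ?E * inverse ?E)"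
    by (simp add: fps_inverse_deriv[OF E0] E' deriv algebra_simps power2_eq_square)
  also have "\<dots> = 0"
    using inverse_mult_eq_1'[OF E0] by simp
  finally have "f * inverse ?E = fps_const ((f * inverse ?E) $ 0)"
    by (simp only: fps_deriv_eq_0_iff)
  hence "f * inverse ?E = 1"
    using f0 by simp
  hence "f * (inverse ?E * ?E) = ?E"
    by (metis mult.assoc mult_1)
  thus ?thesis
    using inverse_mult_eq_1[OF E0] by simp
qed

text \<open>The product on the right has logarithmic derivative
  \<open>fps_deriv a + fps_deriv b\<close> and constant term 1.\<close>

lemma fps_exp_compose_add:
  fixes a b :: "'a::field_char_0 fps"
  assumes "a $ 0 = 0" "b $ 0 = 0"
  shows "fps_exp 1 oo (a + b) = (fps_exp 1 oo a) * (fps_exp 1 oo b)"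
  by (rule fps_eq_exp_compose [symmetric])
     (simp_all add: assms fps_compose_deriv algebra_simps)

lemma fps_exp_compose_sum:
  fixes g :: "'i \<Rightarrow> 'a::field_char_0 fps"
  assumes "\<And>i. i \<in> S \<Longrightarrow> g i $ 0 = 0"
  shows "fps_exp 1 oo (\<Sum>i\<in>S. g i) = (\<Prod>i\<in>S. fps_exp 1 oo g i)"
  using assms
  by (induction S rule: infinite_finite_induct) (simp_all add: fps_exp_compose_add fps_sum_nth)

lemma fps_deriv_inverse_power:
  fixes u :: "'a::field fps"
  assumes "u $ 0 \<noteq> 0"
  shows "fps_deriv (inverse u ^ m) = - of_nat m * fps_deriv u * inverse u * inverse u ^ m"
  by (induction m)
     (simp_all add: fps_inverse_deriv[OF assms] power2_eq_square algebra_simps del: fps_deriv_power)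

text \<open>The exponent is \<open>- m\<close> times the logarithm of \<open>1 - (c X)^d\<close>,
  that is, \<open>m\<close> times the sum of \<open>(c X)^(d s) / s\<close> over
  \<open>s \<ge> 1\<close>. With \<open>r = d s\<close> the coefficient \<open>m / s\<close> becomes
  \<open>d m / r\<close>.\<close>

lemma inverse_one_minus_power_eq_exp:
  fixes c :: "'a::field_char_0"
  assumes d: "d > 0"
  shows "inverse (1 - (fps_const c * fps_X) ^ d) ^ m =
           fps_exp 1 oo Abs_fps (\<lambda>r. if r \<noteq> 0 \<and> d dvd r then of_nat (d * m) * c ^ r / of_nat r else 0)"
    (is "inverse ?u ^ m = _ oo ?g")
proof (rule fps_eq_exp_compose)
  have u: "?u = 1 - fps_const (c ^ d) * fps_X ^ d"
    by (simp add: power_mult_distrib fps_const_power)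
  have u0: "?u $ 0 = 1"
    using d by (simp add: u)
  show "(inverse ?u ^ m) $ 0 = 1"
    using d by (simp add: fps_power_zeroth zero_power)
  show "?g $ 0 = 0"
    by simp
  \<comment> \<open>With the denominator cleared, the equation for the logarithmic derivative can be
    checked coefficient by coefficient.\<close>
  have "fps_deriv ?g * ?u = - of_nat m * fps_deriv ?u"
  proof (rule fps_ext)
    fix k
    \<comment> \<open>Differentiation shifts the index to \<open>Suc k\<close> and cancels the
      denominator.\<close>
    have g': "fps_deriv ?g $ k = (if d dvd Suc k then of_nat (d * m) * c ^ Suc k else 0)" for k
      by (simp del: of_nat_Suc power_Suc)
    have dvd: "d dvd Suc k \<longleftrightarrow> d dvd Suc (k - d)" if "d \<le> k"
      using that dvd_minus_self[of d "Suc k"] by (simp add: Suc_diff_le)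
    have less: "d dvd Suc k \<longleftrightarrow> Suc k = d" if "k < d"
      using that by (auto dest: dvd_imp_le)
    \<comment> \<open>Multiplication by \<open>?u\<close> subtracts \<open>c ^ d\<close> times the
      coefficient \<open>d\<close> places earlier. For \<open>k \<ge> d\<close> the two terms
      cancel, as divisibility by \<open>d\<close> is periodic; below \<open>d\<close> only
      \<open>Suc k = d\<close> survives.\<close>
    have "(fps_deriv ?g * ?u) $ k =
            fps_deriv ?g $ k - c ^ d * (if k < d then 0 else fps_deriv ?g $ (k - d))"
      unfolding u by (simp add: ring_distribs mult.assoc [symmetric] mult.commute[of _ "fps_const _"]
          fps_X_power_mult_right_nth del: fps_deriv_nth)
    also have "\<dots> = (if Suc k = d then of_nat (d * m) * c ^ d else 0)"
      unfolding g' using dvd less by (auto simp: power_add [symmetric] simp del: of_nat_mult)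
    also have "\<dots> = (- of_nat m * fps_deriv ?u) $ k"
      unfolding u by (auto simp: fps_X_power_nth mult_ac simp flip: fps_of_nat)
    finally show "(fps_deriv ?g * ?u) $ k = (- of_nat m * fps_deriv ?u) $ k" .
  qed
  hence "fps_deriv ?g * (?u * inverse ?u) = - of_nat m * fps_deriv ?u * inverse ?u"
    by (simp only: mult.assoc [symmetric])
  moreover have "?u * inverse ?u = 1"
    by (rule inverse_mult_eq_1') (simp only: u0 one_neq_zero not_False_eq_True)
  ultimately have g': "fps_deriv ?g = - of_nat m * fps_deriv ?u * inverse ?u"
    by (simp only: mult_1_right)
  show "fps_deriv (inverse ?u ^ m) = fps_deriv ?g * inverse ?u ^ m"
    unfolding g' by (rule fps_deriv_inverse_power) (simp only: u0 one_neq_zero not_False_eq_True)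
qed

lemma fps_powi_minus: "(f :: 'a::field fps) powi (- int m) = inverse f ^ m"
  by (cases m) (auto simp: power_int_def nat_add_distrib simp del: power_Suc)

section \<open>Integer polynomials inside power series\<close>

lemma map_poly_of_int_mult:
  "map_poly of_int (P * Q :: int poly) = (map_poly of_int P * map_poly of_int Q :: 'a::comm_ring_1 poly)"
  by (rule poly_eqI) (simp add: coeff_map_poly coeff_mult)

lemma map_poly_of_int_power:
  "map_poly of_int (P ^ m :: int poly) = (map_poly of_int P ^ m :: 'a::comm_ring_1 poly)"
  by (induction m) (simp_all add: map_poly_of_int_mult)

lemma map_poly_of_int_prod:
  "map_poly of_int (\<Prod>i\<in>S. P i :: int poly) = (\<Prod>i\<in>S. map_poly of_int (P i) :: 'a::comm_ring_1 poly)"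
  by (induction S rule: infinite_finite_induct) (simp_all add: map_poly_of_int_mult)

text \<open>With \<open>b = q ^ j\<close> this is the source of the integer coefficients of the
  inverse zeta function.\<close>

lemma fps_of_int_poly_one_minus_monom:
  "fps_of_poly (map_poly of_int (1 - monom (b ^ d) d)) =
     1 - (fps_const (of_int b) * fps_X :: 'a::field fps) ^ d"
proof -
  have "map_poly of_int (1 - monom (b ^ d) d) = (1 - monom (of_int b ^ d) d :: 'a poly)"
    by (rule poly_eqI) (simp add: coeff_map_poly)
  thus ?thesis
    by (simp add: fps_of_poly_simps power_mult_distrib fps_const_power)
qed

section \<open>Divisors of \<open>q ^ r - 1\<close> and multiplicative orders\<close>

text \<open>The divisibility is the congruence of \<open>q ^ r\<close> and 1 modulo
  \<open>e\<close>. As \<open>ord e q\<close> is 0 when \<open>e\<close> and \<open>q\<close> are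
  not coprime, \<open>ord e q dvd r\<close> with \<open>r > 0\<close> already forces
  coprimality.\<close>

lemma dvd_power_minus_one_iff:
  fixes q e r :: nat
  assumes "q > 1" "r > 0"
  shows "e dvd q ^ r - 1 \<longleftrightarrow> e \<ge> 1 \<and> coprime e q \<and> ord e q dvd r"
proof -
  have "q ^ r > 1"
    using assms by (rule one_less_power)
  hence "e dvd q ^ r - 1 \<longleftrightarrow> [q ^ r = 1] (mod e)"
    by (simp add: cong_altdef_nat)
  also have "\<dots> \<longleftrightarrow> ord e q dvd r"
    by (rule ord_divides)
  finally have *: "e dvd q ^ r - 1 \<longleftrightarrow> ord e q dvd r" .
  moreover have "coprime e q" if "ord e q dvd r"
    using that assms ord_eq_0[of e q] by (cases "ord e q = 0") auto
  moreover have "e \<noteq> 0" if "e dvd q ^ r - 1"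
    using that \<open>q ^ r > 1\<close> by (cases e) auto
  ultimately show ?thesis by auto
qed

section \<open>Orbit counts over all extensions and the product formula\<close>

theorem theorem7p4:
  fixes k :: "('a, 'm) ring_scheme"
    and F :: "nat \<Rightarrow> ('b, 'l) ring_scheme"
    and p q n :: nat
    and w :: "nat \<Rightarrow> nat"
  assumes "field k" and "finite (carrier k)"
    and "q = card (carrier k)" and "p = ring_characteristic k"
    and "\<And>r. r \<ge> 1 \<Longrightarrow> field (F r)"
    and "\<And>r. r \<ge> 1 \<Longrightarrow> card (carrier (F r)) = q ^ r"
    and "\<And>i. i \<le> n \<Longrightarrow> w i > 0"
  shows
    "(\<forall>r\<ge>1. finite {e. e \<ge> 1 \<and> \<not> p dvd e \<and> ord e q dvd r} \<and>
        (of_nat (weighted_orbit_count (F r) w n) :: rat) =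
          (\<Sum>e | e \<ge> 1 \<and> \<not> p dvd e \<and> ord e q dvd r.
             of_nat (totient e) * ((of_nat q ^ (r * weight_multiplicity w n e) - 1) / (of_nat q ^ r - 1))) \<and>
        weighted_orbit_count (F r) w n =
          (\<Sum>e | e \<ge> 1 \<and> \<not> p dvd e \<and> ord e q dvd r.
             totient e * card (projective_points (F r) (weight_multiplicity w n e)))) \<and>
     finite {e. e \<ge> 1 \<and> \<not> p dvd e \<and> weight_multiplicity w n e \<ge> 1} \<and>
     (\<forall>e. e \<ge> 1 \<and> \<not> p dvd e \<and> weight_multiplicity w n e \<ge> 1 \<longrightarrow>
        ord e q dvd totient e \<and> totient e div ord e q > 0) \<and>
     twist_zeta F w n =
       (\<Prod>e | e \<ge> 1 \<and> \<not> p dvd e \<and> weight_multiplicity w n e \<ge> 1.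
          \<Prod>j\<in>{0..<weight_multiplicity w n e}.
            (1 - (fps_const (of_nat q ^ j) * fps_X) ^ ord e q)
              powi (- int (totient e div ord e q))) \<and>
     (\<exists>P :: int poly. inverse (twist_zeta F w n) = fps_of_poly (map_poly of_int P))"
proof -
  interpret k: field k by fact
  let ?D = "\<lambda>r. {e. e \<ge> 1 \<and> \<not> p dvd e \<and> ord e q dvd r}"
  let ?N = "weight_multiplicity w n"
  let ?S = "{e. e \<ge> 1 \<and> \<not> p dvd e \<and> ?N e \<ge> 1}"
  let ?A = "\<lambda>r. weighted_orbit_count (F r) w n"
  have q1: "q > 1"
    using k.one_less_card assms by simp
  have not_p_dvd: "\<not> p dvd e \<longleftrightarrow> coprime e q" for e
    using k.coprime_card_iff_not_ring_characteristic_dvd[of e] assms by simp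
  \<comment> \<open>The index set consists of the divisors of the order of the multiplicative group
    of \<open>F r\<close>.\<close>
  have D: "?D r = {e. e dvd q ^ r - 1}" if "r \<ge> 1" for r
    using dvd_power_minus_one_iff[OF q1, of r] that by (auto simp: not_p_dvd)
  have Q1: "q ^ r > 1" if "r \<ge> 1" for r
    using one_less_power[OF q1, of r] that by simp
  have Q1_rat: "(of_nat q ^ r :: rat) \<noteq> 1" if "r \<ge> 1" for r
    using Q1[OF that] by (metis less_irrefl of_nat_eq_1_iff of_nat_power)
  \<comment> \<open>Sums over an infinite index set would be 0 by convention.\<close>
  have finD: "finite (?D r)" if "r \<ge> 1" for r
    using D[OF that] Q1[OF that] by simp
  have finF: "finite (carrier (F r))" if "r \<ge> 1" for r
    using assms(6)[OF that] Q1[OF that] by (intro card_ge_0_finite) linarith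
  have proj: "card (projective_points (F r) N) * (q ^ r - 1) = (q ^ r) ^ N - 1" if "r \<ge> 1" for r N
    using field.card_projective_points[OF assms(5) finF] assms(6) that by simp
  have proj_rat: "of_nat (card (projective_points (F r) N)) =
      ((of_nat q ^ (r * N) - 1) / (of_nat q ^ r - 1) :: rat)" if "r \<ge> 1" for r N
  proof -
    \<comment> \<open>No subtraction of natural numbers truncates here, so the identity passes to
      the rationals.\<close>
    have "of_nat (card (projective_points (F r) N)) * (of_nat q ^ r - 1 :: rat) =
        of_nat (card (projective_points (F r) N) * (q ^ r - 1))"
      using Q1[OF that] by (simp add: of_nat_diff)
    also have "\<dots> = of_nat q ^ (r * N) - 1"
      unfolding proj[OF that] using q1 by (simp add: of_nat_diff power_mult)
    finally show ?thesis
      using Q1_rat[OF that] by (simp add: eq_divide_eq)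
  qed
  have count: "?A r = (\<Sum>e\<in>?D r. totient e * card (projective_points (F r) (?N e)))" if r: "r \<ge> 1" for r
  proof -
    have "?A r * (q ^ r - 1) = (\<Sum>e | e dvd q ^ r - 1. totient e * ((q ^ r) ^ ?N e - 1))"
      using field.card_orbits_weighted_scaling[OF assms(5) finF, of r "{0..n}" w] r assms(6)[OF r]
      by (simp add: weighted_orbit_count_def weight_multiplicity_def)
    \<comment> \<open>Each power minus 1 is a number of projective points times
      \<open>q ^ r - 1\<close>, and this common factor is then cancelled.\<close>
    also have "\<dots> = (\<Sum>e\<in>?D r. totient e * card (projective_points (F r) (?N e))) * (q ^ r - 1)"
      unfolding D[OF r] sum_distrib_right proj[OF r, symmetric] mult.assoc ..
    finally show ?thesis
      using Q1[OF r] by simp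
  qed
  have count_rat: "(of_nat (?A r) :: rat) = (\<Sum>e\<in>?D r. of_nat (totient e) *
      ((of_nat q ^ (r * ?N e) - 1) / (of_nat q ^ r - 1)))" if "r \<ge> 1" for r
    by (simp add: count[OF that] proj_rat[OF that])
  \<comment> \<open>Every such \<open>e\<close> divides some weight, and a positive weight has
    finitely many divisors.\<close>
  have finS: "finite ?S"
  proof (rule finite_subset)
    show "?S \<subseteq> (\<Union>i\<in>{0..n}. {e. e dvd w i})"
      by (auto simp: weight_multiplicity_def Suc_le_eq card_gt_0_iff)
    show "finite (\<Union>i\<in>{0..n}. {e. e dvd w i})"
      using assms(7) by auto
  qed
  \<comment> \<open>Coprimality to \<open>q\<close> excludes the default value 0 of
    \<open>ord\<close>.\<close>
  have ord_pos: "ord e q > 0" if "e \<in> ?S" for e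
    using that ord_eq_0[of e q] by (auto simp: not_p_dvd)
  have ord_dvd: "ord e q dvd totient e" if "e \<in> ?S" for e
    using that by (auto simp: not_p_dvd intro!: order_divides_totient)
  have totient_pos: "totient e div ord e q > 0" if "e \<in> ?S" for e
    using dvd_imp_le[OF ord_dvd[OF that]] ord_pos[OF that] that by (simp add: div_greater_zero_iff)
  let ?u = "\<lambda>e j. 1 - (fps_const (of_nat q ^ j) * fps_X :: rat fps) ^ ord e q"
  let ?m = "\<lambda>e. totient e div ord e q"
  \<comment> \<open>This is \<open>- ?m e\<close> times the logarithm of \<open>?u e j\<close>: the
    product of \<open>ord e q\<close> and \<open>?m e\<close> is \<open>totient e\<close>.\<close>
  let ?g = "\<lambda>e j. Abs_fps (\<lambda>r. if r \<noteq> 0 \<and> ord e q dvd r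
      then of_nat (totient e) * (of_nat q ^ j) ^ r / of_nat r else 0 :: rat)"
  have log: "Abs_fps (\<lambda>r. if r = 0 then 0 else of_nat (?A r) / of_nat r) =
      (\<Sum>e\<in>?S. \<Sum>j\<in>{0..<?N e}. ?g e j)" (is "?L = ?R")
  proof (rule fps_ext)
    fix r
    show "?L $ r = ?R $ r"
    proof (cases "r = 0")
      case True
      thus ?thesis by (simp add: fps_sum_nth)
    next
      case False
      hence r: "r \<ge> 1" by simp
      have geom: "(of_nat q ^ (r * N) - 1) / (of_nat q ^ r - 1) =
          (\<Sum>j\<in>{0..<N}. (of_nat q ^ j) ^ r :: rat)" for N
      proof -
        have "(of_nat q ^ j) ^ r = ((of_nat q ^ r) ^ j :: rat)" for j
          by (metis mult.commute power_mult)
        thus ?thesis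
          using geometric_sum[OF Q1_rat[OF r], of N] by (simp only: power_mult atLeast0LessThan)
      qed
      have "?R $ r = (\<Sum>e\<in>?S. if ord e q dvd r
          then of_nat (totient e) * (\<Sum>j\<in>{0..<?N e}. (of_nat q ^ j) ^ r) / of_nat r else 0)"
        using False by (auto simp: fps_sum_nth sum_distrib_left sum_divide_distrib intro!: sum.cong)
      \<comment> \<open>Terms whose order does not divide \<open>r\<close> vanish.\<close>
      also have "\<dots> = (\<Sum>e\<in>?S \<inter> ?D r.
          of_nat (totient e) * (\<Sum>j\<in>{0..<?N e}. (of_nat q ^ j) ^ r) / of_nat r)"
        by (rule sum.mono_neutral_cong_right) (use finS in auto)
      \<comment> \<open>The indices gained have \<open>?N e = 0\<close>, so their inner sum is
        empty.\<close>
      also have "\<dots> = (\<Sum>e\<in>?D r.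
          of_nat (totient e) * (\<Sum>j\<in>{0..<?N e}. (of_nat q ^ j) ^ r) / of_nat r)"
        by (rule sum.mono_neutral_left) (use finD[OF r] in \<open>auto simp: Suc_le_eq intro!: gr0I\<close>)
      also have "\<dots> = of_nat (?A r) / of_nat r"
        unfolding count_rat[OF r] geom by (rule sum_divide_distrib [symmetric])
      finally show ?thesis using False by simp
    qed
  qed
  have zeta: "twist_zeta F w n = (\<Prod>e\<in>?S. \<Prod>j\<in>{0..<?N e}. ?u e j powi (- int (?m e)))"
  proof -
    \<comment> \<open>The exponential turns the double sum into a double product, since every
      \<open>?g e j\<close> has constant term 0.\<close>
    have "twist_zeta F w n = (\<Prod>e\<in>?S. \<Prod>j\<in>{0..<?N e}. fps_exp 1 oo ?g e j)"
      unfolding twist_zeta_def log by (simp add: fps_exp_compose_sum fps_sum_nth)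
    also have "\<dots> = (\<Prod>e\<in>?S. \<Prod>j\<in>{0..<?N e}. ?u e j powi (- int (?m e)))"
    proof (intro prod.cong refl)
      fix e j assume e: "e \<in> ?S"
      show "fps_exp 1 oo ?g e j = ?u e j powi (- int (?m e))"
        by (simp only: fps_powi_minus inverse_one_minus_power_eq_exp[OF ord_pos[OF e]]
            dvd_mult_div_cancel[OF ord_dvd[OF e]])
    qed
    finally show ?thesis .
  qed
  have "inverse (twist_zeta F w n) = (\<Prod>e\<in>?S. \<Prod>j\<in>{0..<?N e}. ?u e j ^ ?m e)"
  proof -
    \<comment> \<open>As \<open>ord e q\<close> is positive, \<open>?u e j\<close> has constant term
      1 and is invertible.\<close>
    have inverse_inverse: "inverse (inverse (?u e j)) = ?u e j" if "e \<in> ?S" for e j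
      using ord_pos[OF that] by (intro fps_inverse_idempotent) (simp add: fps_power_zeroth zero_power)
    show ?thesis
      unfolding zeta fps_powi_minus inverse_prod_fps
      by (intro prod.cong refl) (simp only: fps_inverse_power inverse_inverse)
  qed
  also have "\<dots> = fps_of_poly (map_poly of_int
      (\<Prod>e\<in>?S. \<Prod>j\<in>{0..<?N e}. (1 - monom ((int q ^ j) ^ ord e q) (ord e q)) ^ ?m e))"
    by (simp only: map_poly_of_int_prod map_poly_of_int_power fps_of_poly_prod fps_of_poly_power
        fps_of_int_poly_one_minus_monom of_int_power of_int_of_nat_eq)
  finally have poly: "\<exists>P :: int poly. inverse (twist_zeta F w n) = fps_of_poly (map_poly of_int P)"
    by blast
  have counts: "\<forall>r\<ge>1. finite (?D r) \<and>
      (of_nat (?A r) :: rat) = (\<Sum>e\<in>?D r. of_nat (totient e) *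
        ((of_nat q ^ (r * ?N e) - 1) / (of_nat q ^ r - 1))) \<and>
      ?A r = (\<Sum>e\<in>?D r. totient e * card (projective_points (F r) (?N e)))"
    using finD count_rat count by blast
  have exponents: "\<forall>e. e \<ge> 1 \<and> \<not> p dvd e \<and> ?N e \<ge> 1 \<longrightarrow> ord e q dvd totient e \<and> ?m e > 0"
    using ord_dvd totient_pos by blast
  show ?thesis
    by (rule conjI[OF counts conjI[OF finS conjI[OF exponents conjI[OF zeta poly]]]])
qed

end
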